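(* Let $p>2$ be a prime and let $d>1$ be a divisor of $p-1$. Let $H$ be a finitely generated subgroup of the free group $F_n$ of rank $n\ge 1$. Then the $(\mathbf{Ab}(p)*\mathbf{Ab}(d))$-closure of $H$ in $F_n$ is computable from a finite generating subset of $H$; that is, there is an algorithm which, given a finite set of reduced words generating $H$, computes the closure of $H$ in the pro-$(\mathbf{Ab}(p)*\mathbf{Ab}(d))$ topology on $F_n$ (for example, in the form of a finite generating set, equivalently of its Stallings automaton).
   Context: A pseudovariety is a class of finite groups closed under taking subgroups, homomorphic images and finitary direct products. $\mathbf{Ab}(m)$ is the pseudovariety of finite abelian groups of exponent dividing $m$. For pseudovarieties $\mathbf{V},\mathbf{W}$, $\mathbf{V}*\mathbf{W}$ is the pseudovariety of all finite groups $G$ having a normal subgroup $N\in\mathbf{V}$ with $G/N\in\mathbf{W}$. For a pseudovariety $\mathbf{V}$, the pro-$\mathbf{V}$ topology on a group $G$ is the group topology in which the normal subgroups $K$ with $G/K\in\mathbf{V}$ form a basis of neighbourhoods of the identity. The Stallings automaton of a finitely generated subgroup $H\le F_A$ is the finite automaton over $A\cup A^{-1}$ with basepoint $H$ obtained by restricting the Schreier coset graph (vertices $Hu$, $u\in F_A$, edges $(Hu,a,Hua)$, $a\in A\cup A^{-1}$) to the vertices $Hu$ with $u$ a prefix of (the reduced form of) some $h\in H$. *)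

theory Defs
  imports
    "HOL-Analysis.Abstract_Topology"
    "HOL-Algebra.Generated_Groups"
    "HOL-Library.Nat_Bijection"
    "HOL-Computational_Algebra.Primes"
begin

section \<open>Free groups as groups of reduced words\<close>

text \<open>The letter \<open>(i, True)\<close> is the \<open>i\<close>-th free generator and \<open>(i, False)\<close> is its formal inverse.\<close>

type_synonym letter = "nat \<times> bool"
type_synonym word = "letter list"

definition letter_inv :: "letter \<Rightarrow> letter"
  where "letter_inv x = (fst x, \<not> snd x)"

fun reduced :: "word \<Rightarrow> bool" where
  "reduced (x # y # w) \<longleftrightarrow> y \<noteq> letter_inv x \<and> reduced (y # w)"
| "reduced _ \<longleftrightarrow> True"

fun push :: "letter \<Rightarrow> word \<Rightarrow> word" where
  "push x [] = [x]"
| "push x (y # w) = (if y = letter_inv x then w else x # y # w)"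

definition free_reduce :: "word \<Rightarrow> word"
  where "free_reduce w = foldr push w []"

definition free_group :: "nat \<Rightarrow> word monoid"
  where "free_group n =
    \<lparr>carrier = {w. reduced w \<and> set w \<subseteq> {..<n} \<times> UNIV},
     monoid.mult = (\<lambda>u v. free_reduce (u @ v)),
     one = []\<rparr>"

lemma letter_inv_letter_inv [simp]: "letter_inv (letter_inv x) = x"
  by (simp add: letter_inv_def)

lemma letter_inv_neq [simp]: "letter_inv x \<noteq> x" "x \<noteq> letter_inv x"
  by (auto simp: letter_inv_def prod_eq_iff)

lemma reduced_tl: "reduced (x # w) \<Longrightarrow> reduced w"
  by (cases w) auto

lemma reduced_push: "reduced w \<Longrightarrow> reduced (push x w)"
  by (cases w) (auto dest: reduced_tl)

lemma push_push_inv: "reduced w \<Longrightarrow> push x (push (letter_inv x) w) = w"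
  by (cases w rule: reduced.cases) auto

lemma set_push: "set (push x w) \<subseteq> insert x (set w)"
  by (cases w) auto

lemma reduced_foldr_push: "reduced v \<Longrightarrow> reduced (foldr push u v)"
  by (induction u) (auto intro: reduced_push)

lemma set_foldr_push: "set (foldr push u v) \<subseteq> set u \<union> set v"
proof (induction u)
  case (Cons x u)
  then show ?case using set_push[of x "foldr push u v"] by auto
qed simp

lemma reduced_free_reduce: "reduced (free_reduce w)"
  by (simp add: free_reduce_def reduced_foldr_push)

lemma set_free_reduce: "set (free_reduce w) \<subseteq> set w"
  using set_foldr_push[of w "[]"] by (simp add: free_reduce_def)

lemma free_reduce_reduced: "reduced w \<Longrightarrow> free_reduce w = w"
proof (induction w)
  case (Cons x w)
  then have "free_reduce w = w" by (auto dest: reduced_tl)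
  with Cons.prems show ?case by (cases w) (auto simp: free_reduce_def)
qed (simp add: free_reduce_def)

lemma foldr_push_push:
  assumes "reduced v" shows "foldr push (push x u) v = push x (foldr push u v)"
proof (cases u)
  case (Cons y w)
  then show ?thesis
    using push_push_inv[OF reduced_foldr_push[OF assms, of w], of x] by auto
qed simp

lemma foldr_push_free_reduce:
  "reduced v \<Longrightarrow> foldr push (free_reduce u) v = foldr push u v"
  by (induction u) (auto simp: free_reduce_def foldr_push_push)

lemma free_reduce_append_left: "free_reduce (free_reduce u @ v) = free_reduce (u @ v)"
  using foldr_push_free_reduce[of "free_reduce v" u] reduced_free_reduce[of v]
  by (simp add: free_reduce_def)

lemma free_reduce_append_right: "free_reduce (u @ free_reduce v) = free_reduce (u @ v)"
  using free_reduce_reduced[OF reduced_free_reduce, of v] by (simp add: free_reduce_def)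

lemma free_reduce_inverse: "free_reduce (map letter_inv (rev w) @ w) = []"
proof (induction w)
  case (Cons x w)
  have "push (letter_inv x) (push x v) = v" if "reduced v" for v
    using push_push_inv[OF that, of "letter_inv x"] by simp
  with Cons show ?case by (simp add: free_reduce_def reduced_foldr_push)
qed (simp add: free_reduce_def)

theorem group_free_group: "group (free_group n)"
proof (rule groupI)
  fix u v w
  assume u: "u \<in> carrier (free_group n)" and v: "v \<in> carrier (free_group n)"
  show "u \<otimes>\<^bsub>free_group n\<^esub> v \<in> carrier (free_group n)"
    using u v set_free_reduce[of "u @ v"]
    by (fastforce simp: free_group_def reduced_free_reduce)
  show "u \<otimes>\<^bsub>free_group n\<^esub> v \<otimes>\<^bsub>free_group n\<^esub> w
      = u \<otimes>\<^bsub>free_group n\<^esub> (v \<otimes>\<^bsub>free_group n\<^esub> w)"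
    by (simp add: free_group_def free_reduce_append_left free_reduce_append_right)
next
  fix w assume w: "w \<in> carrier (free_group n)"
  show "\<one>\<^bsub>free_group n\<^esub> \<otimes>\<^bsub>free_group n\<^esub> w = w"
    using w by (simp add: free_group_def free_reduce_reduced)
  let ?v = "free_reduce (map letter_inv (rev w))"
  have "?v \<in> carrier (free_group n)"
    using w set_free_reduce[of "map letter_inv (rev w)"]
    by (fastforce simp: free_group_def reduced_free_reduce letter_inv_def)
  moreover have "?v \<otimes>\<^bsub>free_group n\<^esub> w = \<one>\<^bsub>free_group n\<^esub>"
    using free_reduce_inverse[of w] by (simp add: free_group_def free_reduce_append_left)
  ultimately show "\<exists>y\<in>carrier (free_group n). y \<otimes>\<^bsub>free_group n\<^esub> w = \<one>\<^bsub>free_group n\<^esub>"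
    by blast
qed (simp add: free_group_def)


section \<open>Pseudovarieties and pro-V topologies\<close>

text \<open>
  A class of groups is a predicate on groups, taken at one carrier type at a time. In a product
  of two classes the quotient has carrier type \<open>'a set\<close>, so the two factors are used at different
  types.
\<close>

definition Ab :: "nat \<Rightarrow> 'a monoid \<Rightarrow> bool"
  where "Ab m G \<longleftrightarrow> comm_group G \<and> finite (carrier G) \<and>
    (\<forall>x\<in>carrier G. x [^]\<^bsub>G\<^esub> m = \<one>\<^bsub>G\<^esub>)"

definition pv_prod :: "('a monoid \<Rightarrow> bool) \<Rightarrow> ('a set monoid \<Rightarrow> bool) \<Rightarrow> 'a monoid \<Rightarrow> bool"
  where "pv_prod V W G \<longleftrightarrow> group G \<and> finite (carrier G) \<and>
    (\<exists>N. N \<lhd> G \<and> V (G\<lparr>carrier := N\<rparr>) \<and> W (G Mod N))"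

text \<open>
  If \<open>V\<close> is a pseudovariety then the normal subgroups with quotient in \<open>V\<close> are closed under finite
  intersections, so their cosets form a base, and not just a subbase, of this topology.
\<close>

definition pro_topology :: "('a set monoid \<Rightarrow> bool) \<Rightarrow> 'a monoid \<Rightarrow> 'a topology"
  where "pro_topology V G =
    topology_generated_by {g <#\<^bsub>G\<^esub> K | g K. g \<in> carrier G \<and> K \<lhd> G \<and> V (G Mod K)}"


section \<open>Computability\<close>

text \<open>Partial recursive functions. \<open>Prec\<close> recurses on, and \<open>Mu\<close> searches over, the first argument.\<close>

datatype recf =
    Zero
  | Succ
  | Proj nat
  | Comp recf "recf list"
  | Prec recf recf
  | Mu recf

text \<open>\<open>rec_eval r xs y\<close>: the computation of \<open>r\<close> on the arguments \<open>xs\<close> halts with result \<open>y\<close>.\<close>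

inductive rec_eval :: "recf \<Rightarrow> nat list \<Rightarrow> nat \<Rightarrow> bool" where
  Zero: "rec_eval Zero xs 0"
| Succ: "rec_eval Succ [x] (Suc x)"
| Proj: "i < length xs \<Longrightarrow> rec_eval (Proj i) xs (xs ! i)"
| Comp: "length ys = length gs \<Longrightarrow> (\<forall>i<length gs. rec_eval (gs ! i) xs (ys ! i)) \<Longrightarrow>
    rec_eval f ys z \<Longrightarrow> rec_eval (Comp f gs) xs z"
| Prec_0: "rec_eval f xs y \<Longrightarrow> rec_eval (Prec f g) (0 # xs) y"
| Prec_Suc: "rec_eval (Prec f g) (k # xs) y \<Longrightarrow> rec_eval g (k # y # xs) z \<Longrightarrow>
    rec_eval (Prec f g) (Suc k # xs) z"
| Mu: "rec_eval f (m # xs) 0 \<Longrightarrow> (\<forall>k<m. \<exists>v. rec_eval f (k # xs) (Suc v)) \<Longrightarrow>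
    rec_eval (Mu f) xs m"

inductive_cases rec_eval_ZeroE: "rec_eval Zero xs y"
inductive_cases rec_eval_SuccE: "rec_eval Succ xs y"
inductive_cases rec_eval_ProjE: "rec_eval (Proj i) xs y"
inductive_cases rec_eval_CompE: "rec_eval (Comp f gs) xs y"
inductive_cases rec_eval_Prec_0E: "rec_eval (Prec f g) (0 # xs) y"
inductive_cases rec_eval_Prec_SucE: "rec_eval (Prec f g) (Suc k # xs) y"
inductive_cases rec_eval_MuE: "rec_eval (Mu f) xs y"

theorem rec_eval_deterministic: "rec_eval r xs y \<Longrightarrow> rec_eval r xs z \<Longrightarrow> y = z"
proof (induction arbitrary: z rule: rec_eval.induct)
  case (Comp ys gs xs f z')
  from Comp.prems obtain ys' where ys': "length ys' = length gs"
    "\<forall>i<length gs. rec_eval (gs ! i) xs (ys' ! i)" "rec_eval f ys' z"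
    by (auto elim: rec_eval_CompE)
  with Comp have "ys = ys'" by (intro nth_equalityI) auto
  with Comp.IH ys' show ?case by blast
next
  case (Mu f m xs)
  from Mu.prems have z: "rec_eval f (z # xs) 0" "\<forall>k<z. \<exists>v. rec_eval f (k # xs) (Suc v)"
    by (auto elim: rec_eval_MuE)
  have "\<not> z < m" using Mu.IH(2) z(1) by (metis nat.distinct(1))
  moreover have "\<not> m < z" using Mu.IH(1) z(2) by (metis nat.distinct(1))
  ultimately show ?case by simp
qed (blast elim: rec_eval_ZeroE rec_eval_SuccE rec_eval_ProjE rec_eval_Prec_0E
      rec_eval_Prec_SucE)+

definition computable_on :: "('a \<Rightarrow> nat) \<Rightarrow> ('b \<Rightarrow> nat) \<Rightarrow> 'a set \<Rightarrow> ('a \<Rightarrow> 'b) \<Rightarrow> bool"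
  where "computable_on cin cout D f \<longleftrightarrow>
    (\<exists>r. \<forall>x\<in>D. rec_eval r [cin x] (cout (f x)))"

definition letter_code :: "letter \<Rightarrow> nat"
  where "letter_code x = prod_encode (fst x, of_bool (snd x))"

definition word_code :: "word \<Rightarrow> nat"
  where "word_code w = list_encode (map letter_code w)"

definition words_code :: "word list \<Rightarrow> nat"
  where "words_code ws = list_encode (map word_code ws)"

lemma inj_words_code: "inj words_code"
proof -
  have "inj letter_code"
    by (auto simp: inj_def letter_code_def prod_eq_iff of_bool_eq_iff)
  then have "inj word_code"
    by (auto simp: inj_def word_code_def list_encode_eq inj_map_eq_map)
  then show ?thesis
    by (auto simp: inj_def words_code_def list_encode_eq inj_map_eq_map)
qed

end

theory Submission
  imports Defs "HOL-Algebra.Zassenhaus"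
begin

text \<open>
  The class \<open>V = Ab p * Ab d\<close> is locally finite, and this makes the closure operator trivial to
  compute. For a finitely generated group \<open>G\<close> put \<open>R = G\<^sup>d[G,G]\<close> and \<open>K = R\<^sup>p[R,R]\<close>. Any normal
  subgroup \<open>L\<close> with \<open>G/L \<in> V\<close> contains \<open>K\<close>: if \<open>M/L\<close> is a normal subgroup of \<open>G/L\<close> in \<open>Ab p\<close>
  with quotient in \<open>Ab d\<close>, then \<open>G/M\<close> is abelian of exponent dividing \<open>d\<close>, so \<open>R \<subseteq> M\<close>, and then
  \<open>R\<close> has an abelian image of exponent dividing \<open>p\<close>
  in \<open>M/L\<close>, so \<open>K \<subseteq> L\<close>. Conversely \<open>G/K \<in> V\<close>, where the point is finiteness. A finitely generated
  abelian group of positive exponent is finite, hence \<open>G/R\<close> is finite, hence \<open>R\<close> is finitely generated by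
  Schreier's lemma (\<open>fin_gen_finite_index\<close>), and the same two steps applied to \<open>R\<close> show that
  \<open>R/K\<close> is finite and \<open>K\<close> is finitely generated. Thus \<open>K\<close> is the least kernel of a map onto a
  group in \<open>V\<close> (\<open>pv_prod_Ab_least_kernel\<close>).

  In a topology with a least basic normal subgroup \<open>K\<close>, the open sets are the unions of cosets of \<open>K\<close>,
  so the closure of a subgroup \<open>H\<close> is \<open>H K\<close> (\<open>pro_topology_closure_of_subgroup\<close>). For \<open>G = F\<^sub>n\<close>, fix a
  finite list \<open>L\<close> of words that generates \<open>K\<close>. It depends on \<open>p\<close>, \<open>d\<close> and \<open>n\<close> alone, and if \<open>S\<close>
  generates \<open>H\<close> then \<open>L @ S\<close> generates \<open>H K\<close>. The algorithm therefore prepends a constant list to its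
  input, and prepending one word is a simple expression in the Cantor pairing function.
\<close>

section \<open>Finitely generated groups\<close>

definition fin_gen :: "('a, 'b) monoid_scheme \<Rightarrow> bool"
  where "fin_gen G \<longleftrightarrow> (\<exists>T. finite T \<and> T \<subseteq> carrier G \<and> generate G T = carrier G)"

lemma fin_gen_hom_image:
  assumes "group_hom G Q h" "h ` carrier G = carrier Q" "fin_gen G"
  shows "fin_gen Q"
proof -
  interpret group_hom G Q h by fact
  obtain T where T: "finite T" "T \<subseteq> carrier G" "generate G T = carrier G"
    using assms(3) by (auto simp: fin_gen_def)
  then have "generate Q (h ` T) = carrier Q"
    using generate_img[of T] assms(2) by simp
  with T assms(2) show ?thesis unfolding fin_gen_def by (intro exI[of _ "h ` T"]) auto
qed

lemma (in normal) fin_gen_Mod: "fin_gen G \<Longrightarrow> fin_gen (G Mod H)"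
proof (rule fin_gen_hom_image)
  show "group_hom G (G Mod H) ((#>) H)"
    using factorgroup_is_group r_coset_hom_Mod
    by (simp add: group_hom_def group_hom_axioms_def is_group)
qed (auto simp: carrier_FactGroup)

text \<open>
  Schreier's lemma. With finitely many coset representatives \<open>C\<close> at hand, each product \<open>c t\<close> of a
  representative and a generator is rewritten as \<open>y c'\<close> with \<open>y \<in> H\<close>, and \<open>Y\<close> collects these
  finitely many \<open>y\<close>. Then the set \<open>\<langle>Y\<rangle> C\<close> absorbs every generator of the group from the right,
  so it is everything as soon as it contains \<open>\<one>\<close>, which is arranged by adding to \<open>Y\<close> some
  \<open>h\<^sub>1 \<in> H\<close> with \<open>\<one> \<in> h\<^sub>1 C\<close>. An \<open>x \<in> H\<close> is then \<open>y c\<close> with \<open>y \<in> \<langle>Y\<rangle> \<subseteq> H\<close>; this forces \<open>c \<in> C \<inter> H\<close>,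
  and these finitely many elements are put into \<open>Y\<close> as well.
\<close>
lemma (in group) fin_gen_finite_index:
  assumes fg: "fin_gen G" and H: "subgroup H G" and fin: "finite (rcosets H)"
  shows "fin_gen (G\<lparr>carrier := H\<rparr>)"
proof -
  obtain T where T: "finite T" "T \<subseteq> carrier G" "generate G T = carrier G"
    using fg by (auto simp: fin_gen_def)
  obtain C where C: "finite C" "C \<subseteq> carrier G" "rcosets H = (#>) H ` C"
  proof -
    have "rcosets H = (#>) H ` carrier G" by (auto simp: RCOSETS_def)
    with fin that show thesis using finite_subset_image[of "rcosets H" "(#>) H" "carrier G"] by auto
  qed
  have cover: "\<exists>c\<in>C. \<exists>h\<in>H. x = h \<otimes> c" if "x \<in> carrier G" for x
  proof -
    have "H #> x \<in> (#>) H ` C" using that C(3) H by (metis rcosetsI subgroup.subset)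
    then obtain c where "c \<in> C" "H #> x = H #> c" by auto
    moreover have "x \<in> H #> x" using that H by (simp add: rcos_self)
    ultimately show ?thesis by (auto simp: r_coset_def)
  qed
  obtain c1 h1 where c1: "c1 \<in> C" "h1 \<in> H" "\<one> = h1 \<otimes> c1" using cover[of \<one>] by auto
  define rep where "rep x = (SOME c. c \<in> C \<and> (\<exists>h\<in>H. x = h \<otimes> c))" for x
  define Y where "Y = insert h1 ((C \<inter> H) \<union>
    (\<Union>c\<in>C. \<Union>t\<in>T \<union> m_inv G ` T. {c \<otimes> t \<otimes> inv (rep (c \<otimes> t))}))"
  have rep: "rep x \<in> C" "x \<otimes> inv (rep x) \<in> H" "x \<otimes> inv (rep x) \<otimes> rep x = x"
    if x: "x \<in> carrier G" for x
  proof -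
    have *: "rep x \<in> C \<and> (\<exists>h\<in>H. x = h \<otimes> rep x)"
      unfolding rep_def by (rule someI_ex) (use cover[OF x] in blast)
    then obtain h where h: "h \<in> H" "x = h \<otimes> rep x" by blast
    have [simp]: "rep x \<in> carrier G" "h \<in> carrier G"
      using * C h subgroup.mem_carrier[OF H] by auto
    have "x \<otimes> inv (rep x) = h"
      using h(2) x by (metis \<open>h \<in> carrier G\<close> \<open>rep x \<in> carrier G\<close> inv_solve_right')
    then show "rep x \<in> C" "x \<otimes> inv (rep x) \<in> H" "x \<otimes> inv (rep x) \<otimes> rep x = x"
      using * h by auto
  qed
  have mem: "t \<in> carrier G" if "t \<in> T \<union> m_inv G ` T" for t using that T by auto
  have YH: "Y \<subseteq> H" unfolding Y_def using c1 rep mem C by (auto simp: subset_iff)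
  have Yc: "Y \<subseteq> carrier G" using YH subgroup.subset[OF H] by blast
  interpret Y: subgroup "generate G Y" G using generate_is_subgroup[OF Yc] .
  have step: "\<exists>y'\<in>generate G Y. \<exists>c'\<in>C. y \<otimes> c \<otimes> t = y' \<otimes> c'"
    if "y \<in> generate G Y" "c \<in> C" "t \<in> T \<union> m_inv G ` T" for y c t
  proof -
    have [simp]: "y \<in> carrier G" "c \<in> carrier G" "t \<in> carrier G"
      using that C mem by auto
    let ?r = "rep (c \<otimes> t)"
    have r: "?r \<in> C" "?r \<in> carrier G" using rep[of "c \<otimes> t"] C by auto
    have s: "c \<otimes> t \<otimes> inv ?r \<in> generate G Y"
      by (rule generate.incl) (use that in \<open>auto simp: Y_def\<close>)
    have "y \<otimes> c \<otimes> t = y \<otimes> (c \<otimes> t \<otimes> inv ?r \<otimes> ?r)"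
      using rep(3)[of "c \<otimes> t"] by (simp add: m_assoc)
    also have "\<dots> = y \<otimes> (c \<otimes> t \<otimes> inv ?r) \<otimes> ?r" using r by (simp add: m_assoc)
    finally show ?thesis using r(1) s that(1) Y.m_closed by blast
  qed
  have absorb: "\<forall>y\<in>generate G Y. \<forall>c\<in>C. \<exists>y'\<in>generate G Y. \<exists>c'\<in>C. y \<otimes> c \<otimes> x = y' \<otimes> c'"
    if "x \<in> generate G T" for x
    using that
  proof induction
    case one
    have "y \<otimes> c \<otimes> \<one> = y \<otimes> c" if "y \<in> generate G Y" "c \<in> C" for y c
      using that C by auto
    then show ?case by blast
  next
    case (eng a b)
    have ab: "a \<in> carrier G" "b \<in> carrier G" using eng T by auto
    show ?case
    proof (intro ballI)
      fix y c assume y: "y \<in> generate G Y" "c \<in> C"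
      then have yc: "y \<in> carrier G" "c \<in> carrier G" using C by auto
      obtain y' c' where "y' \<in> generate G Y" "c' \<in> C" "y \<otimes> c \<otimes> a = y' \<otimes> c'"
        using eng.IH(1) y by blast
      moreover have "y \<otimes> c \<otimes> (a \<otimes> b) = y \<otimes> c \<otimes> a \<otimes> b" using ab yc by (simp add: m_assoc)
      ultimately show "\<exists>y'\<in>generate G Y. \<exists>c'\<in>C. y \<otimes> c \<otimes> (a \<otimes> b) = y' \<otimes> c'"
        using eng.IH(2) by simp
    qed
  qed (use step in blast)+
  have "H \<subseteq> generate G Y"
  proof
    fix x assume x: "x \<in> H"
    have xc: "x \<in> carrier G" using subgroup.mem_carrier[OF H x] .
    have "h1 \<in> generate G Y" by (rule generate.incl) (simp add: Y_def)
    then obtain y c where yc: "y \<in> generate G Y" "c \<in> C" "x = y \<otimes> c"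
      using absorb[of x] c1 T(3) xc by (metis l_one)
    have yH: "y \<in> H" using yc(1) generate_subgroup_incl[OF YH H] by blast
    have "c = inv y \<otimes> x" using yc C by (metis Y.mem_carrier inv_solve_left subsetD xc)
    then have "c \<in> H" using yH x H by (simp add: subgroup.m_closed subgroup.m_inv_closed)
    then have "c \<in> generate G Y" using yc by (auto simp: Y_def intro: generate.incl)
    with yc show "x \<in> generate G Y" by simp
  qed
  then have "generate G Y = H" using generate_subgroup_incl[OF YH H] by blast
  then have "generate (G\<lparr>carrier := H\<rparr>) Y = H" using generate_consistent[OF YH H] by simp
  moreover have "finite Y" using T C by (auto simp: Y_def)
  ultimately show ?thesis using YH by (auto simp: fin_gen_def)
qed

text \<open>
  The subgroup generated by \<open>insert t T\<close> is the product of those generated by \<open>t\<close> and by \<open>T\<close>,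
  and the powers of \<open>t\<close> are already exhausted by the exponents below \<open>m\<close>.
\<close>
lemma (in comm_group) finite_generate_exponent:
  assumes "finite T" "T \<subseteq> carrier G" and m: "m > 0" and "\<forall>x\<in>carrier G. x [^] (m::nat) = \<one>"
  shows "finite (generate G T)"
  using assms(1,2)
proof (induction T)
  case empty
  then show ?case by (simp add: generate_empty)
next
  case (insert t T)
  have t: "t \<in> carrier G" and T: "T \<subseteq> carrier G" using insert.prems by auto
  have "generate G {t} = (\<lambda>k. t [^] k) ` {0..<int m}"
  proof -
    have "t [^] k \<in> (\<lambda>k. t [^] k) ` {0..<int m}" for k :: int
    proof -
      have "t [^] (k - k mod int m) = \<one>"
      proof -
        have "k - k mod int m = int m * (k div int m)" by (simp add: minus_mod_eq_mult_div)
        then have "t [^] (k - k mod int m) = (t [^] int m) [^] (k div int m)"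
          using t by (simp add: int_pow_pow)
        also have "t [^] int m = \<one>" using assms(4) t by (simp add: int_pow_int)
        finally show ?thesis by (simp add: int_pow_one)
      qed
      moreover have "t [^] k = t [^] (k - k mod int m) \<otimes> t [^] (k mod int m)"
        using t by (simp flip: int_pow_mult)
      ultimately show ?thesis using t m by (intro image_eqI[of _ _ "k mod int m"]) auto
    qed
    then show ?thesis using generate_pow[OF t] by auto
  qed
  then have "finite (generate G {t})" by simp
  moreover have "finite (generate G T)" using insert T by blast
  moreover have "generate G (insert t T) \<subseteq> generate G {t} <#> generate G T"
  proof (rule generate_subgroup_incl)
    have sub: "subgroup (generate G {t}) G" "subgroup (generate G T) G"
      using t T by (auto intro!: generate_is_subgroup)
    show "subgroup (generate G {t} <#> generate G T) G"
      using mult_subgroups[OF sub] .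
    have "t = t \<otimes> \<one>" "\<And>x. x \<in> T \<Longrightarrow> x = \<one> \<otimes> x" using t T by auto
    then show "insert t T \<subseteq> generate G {t} <#> generate G T"
      unfolding set_mult_def by (blast intro: generate.intros)
  qed
  ultimately show ?case
    by (auto simp: set_mult_def intro: finite_subset)
qed

section \<open>Abelian quotients of bounded exponent\<close>

lemma (in normal) coset_eq_iff:
  assumes "x \<in> carrier G" "y \<in> carrier G"
  shows "H #> x = H #> y \<longleftrightarrow> x \<otimes> inv y \<in> H"
proof
  assume "H #> x = H #> y"
  then show "x \<otimes> inv y \<in> H"
    using assms rcos_self[OF assms(1) is_subgroup] rcos_module_imp[OF is_group assms(2)] by simp
next
  assume "x \<otimes> inv y \<in> H"
  then have "x \<in> H #> y" using assms rcos_module_rev[OF is_group] by blast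
  then show "H #> x = H #> y" using assms repr_independence[OF _ _ is_subgroup] by simp
qed

lemma (in normal) comm_group_Mod_iff:
  "comm_group (G Mod H) \<longleftrightarrow> derived_set G (carrier G) \<subseteq> H"
proof -
  interpret Q: group "G Mod H" by (rule factorgroup_is_group)
  have "comm_group (G Mod H) \<longleftrightarrow> (\<forall>x\<in>carrier G. \<forall>y\<in>carrier G. H #> (x \<otimes> y) = H #> (y \<otimes> x))"
  proof
    assume "comm_group (G Mod H)"
    then interpret Q': comm_group "G Mod H" .
    show "\<forall>x\<in>carrier G. \<forall>y\<in>carrier G. H #> (x \<otimes> y) = H #> (y \<otimes> x)"
    proof (intro ballI)
      fix x y assume "x \<in> carrier G" "y \<in> carrier G"
      then show "H #> (x \<otimes> y) = H #> (y \<otimes> x)"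
        using Q'.m_comm[of "H #> x" "H #> y"] by (simp add: carrier_FactGroup rcos_sum)
    qed
  next
    assume "\<forall>x\<in>carrier G. \<forall>y\<in>carrier G. H #> (x \<otimes> y) = H #> (y \<otimes> x)"
    then show "comm_group (G Mod H)"
      by (intro Q.group_comm_groupI) (auto simp: carrier_FactGroup rcos_sum)
  qed
  also have "\<dots> \<longleftrightarrow> derived_set G (carrier G) \<subseteq> H"
    by (auto simp: coset_eq_iff inv_mult_group m_assoc)
  finally show ?thesis .
qed

lemma (in normal) pow_Mod_iff:
  "(\<forall>x\<in>carrier (G Mod H). x [^]\<^bsub>G Mod H\<^esub> (m::nat) = \<one>\<^bsub>G Mod H\<^esub>) \<longleftrightarrow>
     (\<forall>x\<in>carrier G. x [^] m \<in> H)"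
proof -
  have "H #> x = H \<longleftrightarrow> x \<in> H" if "x \<in> carrier G" for x
    using that coset_join1[OF _ _ is_subgroup] coset_join2[OF _ is_subgroup] by blast
  then show ?thesis by (auto simp: carrier_FactGroup FactGroup_pow)
qed

lemma (in normal) Ab_Mod_iff:
  "Ab m (G Mod H) \<longleftrightarrow> finite (carrier (G Mod H)) \<and> derived_set G (carrier G) \<subseteq> H \<and>
     (\<forall>x\<in>carrier G. x [^] m \<in> H)"
  unfolding Ab_def comm_group_Mod_iff pow_Mod_iff by blast

lemma (in normal) Ab_Mod_fin_gen:
  assumes "fin_gen G" "m > 0" "derived_set G (carrier G) \<subseteq> H" "\<forall>x\<in>carrier G. x [^] m \<in> H"
  shows "Ab m (G Mod H)"
proof -
  interpret Q: comm_group "G Mod H" using assms(3) by (simp add: comm_group_Mod_iff)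
  obtain T where T: "finite T" "T \<subseteq> carrier (G Mod H)" "generate (G Mod H) T = carrier (G Mod H)"
    using fin_gen_Mod[OF assms(1)] by (auto simp: fin_gen_def)
  have "finite (generate (G Mod H) T)"
    using T assms(2,4) pow_Mod_iff[of m] by (intro Q.finite_generate_exponent[of _ m]) blast+
  with T assms show ?thesis by (simp add: Ab_Mod_iff)
qed

text \<open>
  For a subgroup \<open>A\<close> this is the verbal subgroup \<open>A\<^sup>m[A,A]\<close>. Both \<open>A\<close> and the ambient group \<open>G\<close> are
  arguments because iterating the construction forms \<open>R\<^sup>p[R,R]\<close> for a subgroup \<open>R\<close>, and the result has
  to be normal in \<open>G\<close>, not merely in \<open>R\<close>.
\<close>
definition power_comm :: "nat \<Rightarrow> ('a, 'b) monoid_scheme \<Rightarrow> 'a set \<Rightarrow> 'a set"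
  where "power_comm m G A = generate G (derived_set G A \<union> {a [^]\<^bsub>G\<^esub> m | a. a \<in> A})"

lemma power_comm_gens:
  "derived_set G A \<subseteq> power_comm m G A" "a \<in> A \<Longrightarrow> a [^]\<^bsub>G\<^esub> m \<in> power_comm m G A"
  unfolding power_comm_def by (intro subsetI generate.incl UnI1) (assumption, rule generate.incl, blast)

lemma (in group) power_comm_least:
  assumes "subgroup H G" "derived_set G A \<subseteq> H" "\<forall>a\<in>A. a [^] m \<in> H"
  shows "power_comm m G A \<subseteq> H"
  unfolding power_comm_def using assms by (intro generate_subgroup_incl) auto

lemma (in group) subgroup_nat_pow_closed:
  "subgroup A G \<Longrightarrow> a \<in> A \<Longrightarrow> a [^] (m::nat) \<in> A"
  by (induction m) (auto simp: subgroup.one_closed subgroup.m_closed)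

lemma (in group) power_comm_incl: "subgroup A G \<Longrightarrow> power_comm m G A \<subseteq> A"
  using power_comm_least[of A A m] derived_set_incl[of A A] subgroup_nat_pow_closed by blast

lemma (in group) power_comm_consistent:
  assumes "subgroup A G"
  shows "power_comm m (G\<lparr>carrier := A\<rparr>) A = power_comm m G A"
proof -
  have "derived_set G A \<union> {a [^] m | a. a \<in> A} \<subseteq> A"
    using derived_set_incl[OF subset_refl assms] subgroup_nat_pow_closed[OF assms] by blast
  then show ?thesis
    unfolding power_comm_def derived_set_consistent[OF subset_refl assms]
    using generate_consistent[OF _ assms] by (simp flip: nat_pow_consistent)
qed

lemma (in group) conj_mult:
  assumes "g \<in> carrier G" "x \<in> carrier G" "y \<in> carrier G"
  shows "g \<otimes> (x \<otimes> y) \<otimes> inv g = (g \<otimes> x \<otimes> inv g) \<otimes> (g \<otimes> y \<otimes> inv g)"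
  using assms by (simp add: inv_solve_left m_assoc)

text \<open>
  Conjugation by \<open>g\<close> is an automorphism of \<open>G\<close> that maps \<open>A\<close> to itself, so it permutes the
  commutators and the \<open>m\<close>-th powers of elements of \<open>A\<close>.
\<close>
lemma (in group) power_comm_normal:
  assumes "A \<lhd> G"
  shows "power_comm m G A \<lhd> G"
  unfolding power_comm_def
proof (rule normal_generateI)
  interpret A: normal A G by fact
  show "derived_set G A \<union> {a [^] m | a. a \<in> A} \<subseteq> carrier G"
    by auto
  fix h g assume h: "h \<in> derived_set G A \<union> {a [^] m | a. a \<in> A}" and g: "g \<in> carrier G"
  have cA: "g \<otimes> a \<otimes> inv g \<in> A" if "a \<in> A" for a using that g A.inv_op_closed2 by blast
  have ci: "g \<otimes> inv a \<otimes> inv g = inv (g \<otimes> a \<otimes> inv g)" if "a \<in> A" for a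
    using that g by (simp add: inv_mult_group m_assoc)
  have cp: "g \<otimes> a [^] m \<otimes> inv g = (g \<otimes> a \<otimes> inv g) [^] m" if "a \<in> A" for a
  proof (induction m)
    case (Suc m)
    then show ?case using that g conj_mult[of g "a [^] m" a] by simp
  qed (use g in simp)
  from h consider a b where "a \<in> A" "b \<in> A" "h = a \<otimes> b \<otimes> inv a \<otimes> inv b"
    | a where "a \<in> A" "h = a [^] m" by auto
  then show "g \<otimes> h \<otimes> inv g \<in> derived_set G A \<union> {a [^] m | a. a \<in> A}"
  proof cases
    case 1
    then have "g \<otimes> h \<otimes> inv g = (g \<otimes> a \<otimes> inv g) \<otimes> (g \<otimes> b \<otimes> inv g)
        \<otimes> inv (g \<otimes> a \<otimes> inv g) \<otimes> inv (g \<otimes> b \<otimes> inv g)"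
      using g by (simp add: conj_mult flip: ci)
    with 1 cA show ?thesis by blast
  next
    case 2
    with cA cp show ?thesis by blast
  qed
qed

lemma (in group) power_comm_fin_gen:
  assumes "fin_gen G" "m > 0"
  defines "R \<equiv> power_comm m G (carrier G)"
  shows "Ab m (G Mod R)" and "fin_gen (G\<lparr>carrier := R\<rparr>)"
proof -
  interpret R: normal R G
    unfolding R_def by (intro power_comm_normal) (simp add: normal_invI subgroup_self)
  show *: "Ab m (G Mod R)"
  proof (rule R.Ab_Mod_fin_gen[OF assms(1,2)])
    show "derived_set G (carrier G) \<subseteq> R" "\<forall>x\<in>carrier G. x [^] m \<in> R"
      using power_comm_gens(1)[of G "carrier G" m] power_comm_gens(2)[of _ "carrier G" G m]
      by (simp_all add: R_def)
  qed
  have "finite (rcosets R)" using * by (simp add: Ab_def FactGroup_def)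
  then show "fin_gen (G\<lparr>carrier := R\<rparr>)"
    using fin_gen_finite_index[OF assms(1) R.is_subgroup] by blast
qed

section \<open>The least kernel for a product of two abelian classes\<close>

theorem (in group) pv_prod_Ab_least_kernel:
  assumes fg: "fin_gen G" and p: "p > 0" and d: "d > 0"
  defines "R \<equiv> power_comm d G (carrier G)"
  defines "K \<equiv> power_comm p G R"
  shows "K \<lhd> G" and "fin_gen (G\<lparr>carrier := K\<rparr>)" and "pv_prod (Ab p) (Ab d) (G Mod K)"
    and "\<And>L. L \<lhd> G \<Longrightarrow> pv_prod (Ab p) (Ab d) (G Mod L) \<Longrightarrow> K \<subseteq> L"
proof -
  have carr: "carrier G \<lhd> G" by (simp add: normal_invI subgroup_self)
  interpret R: normal R G
    unfolding R_def by (rule power_comm_normal[OF carr])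
  show K: "K \<lhd> G" unfolding K_def by (rule power_comm_normal[OF R.normal_axioms])
  then interpret K: normal K G .
  interpret GR: group "G\<lparr>carrier := R\<rparr>" using R.subgroup_is_group[OF is_group] .
  have fgR: "fin_gen (G\<lparr>carrier := R\<rparr>)"
    using power_comm_fin_gen[OF fg d] by (simp add: R_def)
  have K_eq: "power_comm p (G\<lparr>carrier := R\<rparr>) (carrier (G\<lparr>carrier := R\<rparr>)) = K"
    using power_comm_consistent[OF R.is_subgroup] by (simp add: K_def)
  show "fin_gen (G\<lparr>carrier := K\<rparr>)"
    using GR.power_comm_fin_gen(2)[OF fgR p] unfolding K_eq by simp
  have AbRK: "Ab p (G\<lparr>carrier := R\<rparr> Mod K)"
    using GR.power_comm_fin_gen(1)[OF fgR p] unfolding K_eq .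
  have KR: "K \<subseteq> R" unfolding K_def by (rule power_comm_incl[OF R.is_subgroup])
  define N where "N = rcosets\<^bsub>G\<lparr>carrier := R\<rparr>\<^esub> K"
  have N_eq: "N = (#>) K ` R" by (auto simp: N_def RCOSETS_def r_coset_def)
  \<comment> \<open>The two groups are equal and not just isomorphic: both consist of the cosets \<open>K #> r\<close> in \<open>G\<close>.\<close>
  have restr: "(G Mod K)\<lparr>carrier := N\<rparr> = G\<lparr>carrier := R\<rparr> Mod K"
    by (simp add: FactGroup_def N_def set_mult_def fun_eq_iff)
  have "N \<lhd> G Mod K" unfolding N_def
    by (rule normality_factorization[OF K KR R.normal_axioms])
  then interpret N: normal N "G Mod K" .
  have "Ab d ((G Mod K) Mod N)"
  proof (rule N.Ab_Mod_fin_gen[OF K.fin_gen_Mod[OF fg] d])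
    have "(K #> x) <#> (K #> y) <#> inv\<^bsub>G Mod K\<^esub> (K #> x) <#> inv\<^bsub>G Mod K\<^esub> (K #> y)
        = K #> (x \<otimes> y \<otimes> inv x \<otimes> inv y)" if "x \<in> carrier G" "y \<in> carrier G" for x y
      using that by (simp add: K.inv_FactGroup carrier_FactGroup K.rcos_inv K.rcos_sum)
    moreover have "x \<otimes> y \<otimes> inv x \<otimes> inv y \<in> R" if "x \<in> carrier G" "y \<in> carrier G" for x y
      unfolding R_def power_comm_def using that by (intro generate.incl) auto
    ultimately show "derived_set (G Mod K) (carrier (G Mod K)) \<subseteq> N"
      by (auto simp: carrier_FactGroup N_eq)
    have "x [^] d \<in> R" if "x \<in> carrier G" for x
      unfolding R_def power_comm_def using that by (intro generate.incl) auto
    then show "\<forall>x\<in>carrier (G Mod K). x [^]\<^bsub>G Mod K\<^esub> d \<in> N"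
      by (auto simp: carrier_FactGroup N_eq K.FactGroup_pow)
  qed
  \<comment> \<open>\<open>G/K\<close> is covered by finitely many cosets of the finite subgroup \<open>R/K\<close>.\<close>
  moreover have "finite (carrier (G Mod K))"
  proof -
    have "finite (rcosets\<^bsub>G Mod K\<^esub> N)" using calculation by (simp add: Ab_def FactGroup_def)
    moreover have "finite N" using AbRK by (simp add: Ab_def FactGroup_def N_def)
    then have "finite C" if "C \<in> rcosets\<^bsub>G Mod K\<^esub> N" for C
      using that by (auto simp: RCOSETS_def r_coset_def)
    ultimately have "finite (\<Union>(rcosets\<^bsub>G Mod K\<^esub> N))" by blast
    then show ?thesis using N.rcosets_part_G[OF N.is_subgroup] by simp
  qed
  ultimately show "pv_prod (Ab p) (Ab d) (G Mod K)"
    unfolding pv_prod_def using K.factorgroup_is_group N.normal_axioms AbRK restr by metis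
  fix L assume L: "L \<lhd> G" and "pv_prod (Ab p) (Ab d) (G Mod L)"
  then obtain M where M: "M \<lhd> G Mod L" "Ab p ((G Mod L)\<lparr>carrier := M\<rparr>)" "Ab d ((G Mod L) Mod M)"
    by (auto simp: pv_prod_def)
  interpret L: normal L G by fact
  interpret M: normal M "G Mod L" by fact
  interpret M': comm_group "(G Mod L)\<lparr>carrier := M\<rparr>" using M(2) by (simp add: Ab_def)
  have comm: "(L #> x) <#> (L #> y) <#> inv\<^bsub>G Mod L\<^esub> (L #> x) <#> inv\<^bsub>G Mod L\<^esub> (L #> y)
      = L #> (x \<otimes> y \<otimes> inv x \<otimes> inv y)" if "x \<in> carrier G" "y \<in> carrier G" for x y
    using that by (simp add: L.inv_FactGroup carrier_FactGroup L.rcos_inv L.rcos_sum)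
  \<comment> \<open>The preimage of \<open>M\<close> in \<open>G\<close> has a quotient in \<open>Ab d\<close>, so it contains \<open>R\<close>.\<close>
  have RM: "L #> x \<in> M" if "x \<in> R" for x
  proof -
    have U: "subgroup {x \<in> carrier G. L #> x \<in> M} G"
      using L.factgroup_subgroup_union_subgroup[OF M.is_subgroup]
        L.factgroup_subgroup_union_char[OF M.is_subgroup] by simp
    have Q: "X \<otimes>\<^bsub>G Mod L\<^esub> Y \<otimes>\<^bsub>G Mod L\<^esub> inv\<^bsub>G Mod L\<^esub> X \<otimes>\<^bsub>G Mod L\<^esub> inv\<^bsub>G Mod L\<^esub> Y \<in> M"
      "X [^]\<^bsub>G Mod L\<^esub> d \<in> M"
      if "X \<in> carrier (G Mod L)" "Y \<in> carrier (G Mod L)" for X Y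
      using M(3) that unfolding M.Ab_Mod_iff by blast+
    have LQ: "L #> x \<in> carrier (G Mod L)" if "x \<in> carrier G" for x
      using that by (simp add: carrier_FactGroup)
    have "L #> (x \<otimes> y \<otimes> inv x \<otimes> inv y) \<in> M" if "x \<in> carrier G" "y \<in> carrier G" for x y
      using Q(1)[OF LQ[OF that(1)] LQ[OF that(2)]] comm[OF that] by simp
    moreover have "L #> (x [^] d) \<in> M" if "x \<in> carrier G" for x
      using Q(2)[OF LQ[OF that] LQ[OF that]] L.FactGroup_pow[OF that] by simp
    ultimately have "R \<subseteq> {x \<in> carrier G. L #> x \<in> M}"
      unfolding R_def by (intro power_comm_least[OF U]) auto
    with that show ?thesis by blast
  qed
  show "K \<subseteq> L" unfolding K_def
  proof (rule power_comm_least[OF L.is_subgroup])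
    have "x \<otimes> y \<otimes> inv x \<otimes> inv y \<in> L" if "x \<in> R" "y \<in> R" for x y
    proof -
      have "L #> (x \<otimes> y) = L #> (y \<otimes> x)"
        using M'.m_comm[of "L #> x" "L #> y"] RM that by (simp add: L.rcos_sum)
      then show ?thesis using that by (simp add: L.coset_eq_iff inv_mult_group m_assoc)
    qed
    then show "derived_set G R \<subseteq> L" by auto
    have "L #> (x [^] p) = L" if "x \<in> R" for x
      using M(2) RM[OF that] that L.FactGroup_pow[of x p] 
        M.nat_pow_consistent[of "L #> x" p M] by (simp add: Ab_def)
    then show "\<forall>x\<in>R. x [^] p \<in> L"
      using coset_join1[OF _ _ L.is_subgroup] by simp
  qed
qed

section \<open>Closures of subgroups\<close>

text \<open>
  Every basic coset \<open>g <# L\<close> is stable under right multiplication by \<open>K \<subseteq> L\<close>, and so is then every open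
  set; hence an open set that contains \<open>h k\<close> also contains \<open>h\<close>, which puts \<open>H K\<close> inside the closure.
  On the other hand \<open>x <# K\<close> is itself open, so a point of the closure has an element of \<open>H\<close> in its
  coset.
\<close>
lemma pro_topology_closure_of_subgroup:
  fixes G :: "'a monoid" (structure)
  assumes "group G"
    and K: "K \<lhd> G" "V (G Mod K)" and least: "\<And>L. L \<lhd> G \<Longrightarrow> V (G Mod L) \<Longrightarrow> K \<subseteq> L"
    and H: "subgroup H G"
  shows "pro_topology V G closure_of H = H <#> K"
proof -
  interpret group G by fact
  interpret K: normal K G by fact
  define B where "B = {g <# L | g L. g \<in> carrier G \<and> L \<lhd> G \<and> V (G Mod L)}"
  have top: "pro_topology V G = topology_generated_by B" by (simp add: pro_topology_def B_def)
  have self: "g \<in> g <# K" if "g \<in> carrier G" for g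
    using that by (auto simp: l_coset_def intro: bexI[of _ "\<one>"])
  have space: "topspace (pro_topology V G) = carrier G"
  proof
    show "topspace (pro_topology V G) \<subseteq> carrier G"
    proof -
      have "g <# L \<subseteq> carrier G" if "g \<in> carrier G" "L \<lhd> G" for g L
        using l_coset_subset_G[OF subgroup.subset[OF normal_imp_subgroup[OF that(2)]] that(1)] .
      then show ?thesis unfolding top topology_generated_by_topspace by (auto simp: B_def)
    qed
    show "carrier G \<subseteq> topspace (pro_topology V G)"
      unfolding top topology_generated_by_topspace B_def using K self by blast
  qed
  have stable: "x \<otimes> k \<in> U" if "generate_topology_on B U" "x \<in> U" "k \<in> K" for U x k
    using that
  proof (induction arbitrary: x)
    case (Basis s)
    then obtain g L where s: "s = g <# L" "g \<in> carrier G" "L \<lhd> G" "K \<subseteq> L"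
      using least by (auto simp: B_def)
    interpret L: normal L G by fact
    obtain l where l: "l \<in> L" "x = g \<otimes> l" using Basis s by (auto simp: l_coset_def)
    then have "x \<otimes> k = g \<otimes> (l \<otimes> k)" "l \<otimes> k \<in> L" using s Basis.prems by (auto simp: m_assoc)
    then show ?case using s by (auto simp: l_coset_def)
  qed auto
  show ?thesis
  proof
    show "pro_topology V G closure_of H \<subseteq> H <#> K"
    proof
      fix x assume x: "x \<in> pro_topology V G closure_of H"
      then have xc: "x \<in> carrier G" using in_closure_of space by metis
      have "openin (pro_topology V G) (x <# K)"
        unfolding top by (rule topology_generated_by_Basis) (use xc K in \<open>auto simp: B_def\<close>)
      with x self[OF xc] obtain h where "h \<in> H" "h \<in> x <# K" by (meson in_closure_of)
      then obtain k where k: "k \<in> K" "h = x \<otimes> k" by (auto simp: l_coset_def)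
      then have "x = h \<otimes> inv k" using xc by (simp add: m_assoc)
      then show "x \<in> H <#> K" using k \<open>h \<in> H\<close> by (auto simp: set_mult_def)
    qed
    show "H <#> K \<subseteq> pro_topology V G closure_of H"
    proof
      fix x assume "x \<in> H <#> K"
      then obtain h k where hk: "h \<in> H" "k \<in> K" "x = h \<otimes> k" by (auto simp: set_mult_def)
      have hc: "h \<in> carrier G" using subgroup.mem_carrier[OF H hk(1)] .
      have "h \<in> U" if "openin (pro_topology V G) U" "x \<in> U" for U
        using stable[of U x "inv k"] that hk hc
        by (simp add: top openin_topology_generated_by_iff m_assoc)
      then show "x \<in> pro_topology V G closure_of H"
        using hk hc space by (auto simp: in_closure_of)
    qed
  qed
qed

lemma (in group) generate_Un_normal:
  assumes K: "generate G L \<lhd> G" and "L \<subseteq> carrier G" "S \<subseteq> carrier G"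
  shows "generate G (L \<union> S) = generate G S <#> generate G L"
proof
  interpret K: normal "generate G L" G by fact
  have S: "subgroup (generate G S) G" using assms generate_is_subgroup by blast
  have "subgroup (generate G S <#> generate G L) G"
    using mult_norm_subgroup[OF K S] commut_normal[OF S K] by simp
  moreover have "L \<union> S \<subseteq> generate G S <#> generate G L"
  proof -
    have "x = \<one> \<otimes> x" "x = x \<otimes> \<one>" if "x \<in> L \<union> S" for x using that assms by auto
    then show ?thesis unfolding set_mult_def by (blast intro: generate.intros)
  qed
  ultimately show "generate G (L \<union> S) \<subseteq> generate G S <#> generate G L"
    by (intro generate_subgroup_incl)
  show "generate G S <#> generate G L \<subseteq> generate G (L \<union> S)"
    using mono_generate[of S "L \<union> S"] mono_generate[of L "L \<union> S"]
    by (auto simp: set_mult_def intro: generate.eng)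
qed

section \<open>The free group is finitely generated\<close>

lemma fin_gen_free_group: "fin_gen (free_group n)"
proof -
  let ?T = "(\<lambda>x. [x]) ` ({..<n} \<times> UNIV)"
  interpret F: group "free_group n" by (rule group_free_group)
  have T: "?T \<subseteq> carrier (free_group n)" by (auto simp: free_group_def)
  have "w \<in> generate (free_group n) ?T" if "w \<in> carrier (free_group n)" for w
    using that
  proof (induction w)
    case Nil
    then show ?case using generate.one[of "free_group n"] by (simp add: free_group_def)
  next
    case (Cons x w)
    then have w: "w \<in> carrier (free_group n)"
      by (auto simp: free_group_def dest: reduced_tl)
    have "[x] \<in> generate (free_group n) ?T"
      using Cons.prems by (intro generate.incl) (auto simp: free_group_def)
    then have "[x] \<otimes>\<^bsub>free_group n\<^esub> w \<in> generate (free_group n) ?T"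
      using Cons.IH[OF w] by (rule generate.eng)
    also have "[x] \<otimes>\<^bsub>free_group n\<^esub> w = x # w"
      using Cons.prems free_reduce_reduced[of "x # w"] by (simp add: free_group_def)
    finally show ?case .
  qed
  then have "generate (free_group n) ?T = carrier (free_group n)"
    using F.generate_incl[OF T] by blast
  with T show ?thesis unfolding fin_gen_def by (intro exI[of _ ?T]) auto
qed

section \<open>Prepending a constant list is recursive\<close>

lemma rec_eval_Comp1:
  "rec_eval g xs y \<Longrightarrow> rec_eval f [y] z \<Longrightarrow> rec_eval (Comp f [g]) xs z"
  by (rule rec_eval.Comp[of "[y]"]) auto

lemma rec_eval_Comp2:
  "rec_eval g xs y \<Longrightarrow> rec_eval h xs z \<Longrightarrow> rec_eval f [y, z] v \<Longrightarrow> rec_eval (Comp f [g, h]) xs v"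
  by (rule rec_eval.Comp[of "[y, z]"]) (auto simp: less_Suc_eq)

lemma rec_eval_Proj: "i < length xs \<Longrightarrow> xs ! i = y \<Longrightarrow> rec_eval (Proj i) xs y"
  using rec_eval.Proj by blast

fun rf_const :: "nat \<Rightarrow> recf" where
  "rf_const 0 = Zero"
| "rf_const (Suc k) = Comp Succ [rf_const k]"

lemma rec_eval_const: "rec_eval (rf_const k) xs k"
  by (induction k) (auto intro: rec_eval.intros rec_eval_Comp1)

definition "rf_add = Prec (Proj 0) (Comp Succ [Proj 1])"

lemma rec_eval_add: "rec_eval rf_add [k, m] (k + m)"
  unfolding rf_add_def
proof (induction k)
  case 0
  show ?case by (rule rec_eval.Prec_0) (rule rec_eval_Proj; simp)
next
  case (Suc k)
  show ?case
    by (rule rec_eval.Prec_Suc[OF Suc], rule rec_eval_Comp1[of _ _ "k + m"])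
      (auto intro: rec_eval_Proj rec_eval.Succ)
qed

definition "rf_triangle = Prec Zero (Comp rf_add [Proj 1, Comp Succ [Proj 0]])"

lemma rec_eval_triangle: "rec_eval rf_triangle [k] (triangle k)"
  unfolding rf_triangle_def
proof (induction k)
  case 0
  show ?case by (auto intro: rec_eval.intros)
next
  case (Suc k)
  have "rec_eval (Comp rf_add [Proj 1, Comp Succ [Proj 0]]) [k, triangle k] (triangle (Suc k))"
    unfolding triangle_Suc
    by (intro rec_eval_Comp2[OF _ _ rec_eval_add] rec_eval_Comp1[OF _ rec_eval.Succ] rec_eval_Proj)
      simp_all
  then show ?case by (rule rec_eval.Prec_Suc[OF Suc])
qed

text \<open>
  The code of \<open>w # S\<close> as a list is \<open>Suc (prod_encode (c, x))\<close>, where \<open>c\<close> and \<open>x\<close> encode \<open>w\<close> and \<open>S\<close>,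
  and \<open>prod_encode (c, x) = triangle (c + x) + c\<close>. Only \<open>x\<close> is an input; \<open>c\<close> is built into the program.
\<close>
definition "rf_cons c =
  Comp Succ [Comp rf_add [Comp rf_triangle [Comp rf_add [rf_const c, Proj 0]], rf_const c]]"

lemma rec_eval_cons: "rec_eval (rf_cons c) [x] (Suc (prod_encode (c, x)))"
  unfolding rf_cons_def prod_encode_def prod.case
  by (intro rec_eval_Comp1[OF _ rec_eval.Succ] rec_eval_Comp2[OF _ _ rec_eval_add]
      rec_eval_Comp1[OF _ rec_eval_triangle] rec_eval_const rec_eval_Proj) simp_all

lemma computable_append_constant:
  "computable_on words_code words_code D (\<lambda>S. L @ S)"
proof -
  have "\<exists>r. \<forall>S. rec_eval r [words_code S] (words_code (L @ S))"
  proof (induction L)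
    case Nil
    show ?case by (rule exI[of _ "Proj 0"]) (auto intro: rec_eval_Proj)
  next
    case (Cons w L)
    then obtain r where "\<forall>S. rec_eval r [words_code S] (words_code (L @ S))" by blast
    then have "rec_eval (Comp (rf_cons (word_code w)) [r]) [words_code S] (words_code ((w # L) @ S))" for S
      using rec_eval_Comp1[OF _ rec_eval_cons] by (simp add: words_code_def)
    then show ?case by blast
  qed
  then show ?thesis by (auto simp: computable_on_def)
qed

section \<open>Computing the closure\<close>

theorem corollary3p3:
  fixes p d n :: nat
  assumes "prime p" and "p > 2"
    and "d > 1" and "d dvd p - 1"
    and "n \<ge> 1"
  shows "\<exists>f :: word list \<Rightarrow> word list.
    computable_on words_code words_code {S. set S \<subseteq> carrier (free_group n)} f \<and>
    (\<forall>H S. subgroup H (free_group n) \<and> set S \<subseteq> carrier (free_group n) \<and>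
        H = generate (free_group n) (set S) \<longrightarrow>
      set (f S) \<subseteq> carrier (free_group n) \<and>
      generate (free_group n) (set (f S)) =
        (pro_topology (pv_prod (Ab p) (Ab d)) (free_group n)) closure_of H)"
proof -
  interpret F: group "free_group n" by (rule group_free_group)
  obtain K where K: "K \<lhd> free_group n" "fin_gen ((free_group n)\<lparr>carrier := K\<rparr>)"
      "pv_prod (Ab p) (Ab d) (free_group n Mod K)"
      "\<And>L. L \<lhd> free_group n \<Longrightarrow> pv_prod (Ab p) (Ab d) (free_group n Mod L) \<Longrightarrow> K \<subseteq> L"
    using F.pv_prod_Ab_least_kernel[OF fin_gen_free_group, of p d] assms by force
  interpret K: normal K "free_group n" by fact
  obtain T where T: "finite T" "T \<subseteq> K" "generate ((free_group n)\<lparr>carrier := K\<rparr>) T = K"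
    using K(2) by (auto simp: fin_gen_def)
  obtain L where L: "set L = T" using T(1) finite_list by blast
  have LK: "generate (free_group n) (set L) = K"
    using F.generate_consistent[OF T(2) K.is_subgroup] T(3) L by simp
  have Lc: "set L \<subseteq> carrier (free_group n)" using L T(2) K.subset by blast
  show ?thesis
  proof (intro exI[of _ "\<lambda>S. L @ S"] conjI allI impI; (elim conjE)?)
    fix H S assume H: "subgroup H (free_group n)" "set S \<subseteq> carrier (free_group n)"
      "H = generate (free_group n) (set S)"
    then show "set (L @ S) \<subseteq> carrier (free_group n)" using Lc by simp
    have "generate (free_group n) (set L \<union> set S) = H <#>\<^bsub>free_group n\<^esub> K"
      using F.generate_Un_normal[of "set L" "set S"] LK K(1) Lc H by simp
    also have "\<dots> = pro_topology (pv_prod (Ab p) (Ab d)) (free_group n) closure_of H"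
      using pro_topology_closure_of_subgroup[of _ _ "pv_prod (Ab p) (Ab d)",
          OF group_free_group K(1,3,4) H(1)] by simp
    finally show "generate (free_group n) (set (L @ S)) =
        pro_topology (pv_prod (Ab p) (Ab d)) (free_group n) closure_of H" by simp
  qed (rule computable_append_constant)
qed

end
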